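(* Let $G$ be a finite group. The group $\mathbb{B}_G$ contains only elements of order two (i.e. $2\alpha=0$ for every $\alpha\in\mathbb{B}_G$) if and only if every complex character of $G$ has values in $\mathbb{R}$.
   Context: Let $G$ be a finite group. For $\gamma\in G$ let $\hat\gamma$ denote its conjugacy class and put $\hat\gamma^{-1}:=\widehat{\gamma^{-1}}$. Let $\Lambda_G$ be the commutative monoid of finite (possibly empty) unordered tuples $[\hat\gamma_1,\ldots,\hat\gamma_q]_G$ of conjugacy classes of nontrivial elements of $G$ (repetitions allowed) such that $\gamma_1\cdots\gamma_q\in[G,G]$ (this does not depend on the order or on the representatives), with addition $\oplus$ given by concatenation. If the class of the identity appears in a written tuple, it is deleted. The group of singular orbit data is $\mathbb{B}_G=\Lambda_G/\langle[\hat\gamma,\hat\gamma^{-1}]_G : \gamma\in G\rangle$, i.e. two tuples are identified iff they have the same reduced form after deleting cancelling pairs $\hat\gamma,\hat\gamma^{-1}$. It is an abelian group with zero the empty tuple and $\ominus[\hat\gamma_1,\ldots,\hat\gamma_q]=[\hat\gamma_1^{-1},\ldots,\hat\gamma_q^{-1}]$. *)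

theory Defs
  imports
    "HOL-Library.Multiset"
    "HOL-Algebra.Group_Action"
    "HOL-Algebra.Generated_Groups"
    "Jordan_Normal_Form.Matrix"
begin

definition conj_class :: "('a, 'b) monoid_scheme \<Rightarrow> 'a \<Rightarrow> 'a set"
  where "conj_class G x = orbit G (\<lambda>g h. g \<otimes>\<^bsub>G\<^esub> h \<otimes>\<^bsub>G\<^esub> inv\<^bsub>G\<^esub> g) x"

text \<open>
  Unordered tuples are multisets of conjugacy classes. The tuple written with
  representatives \<open>gs\<close> has every occurrence of the class of the identity deleted.
\<close>

definition class_tuple :: "('a, 'b) monoid_scheme \<Rightarrow> 'a list \<Rightarrow> 'a set multiset"
  where "class_tuple G gs =
    filter_mset (\<lambda>C. C \<noteq> conj_class G \<one>\<^bsub>G\<^esub>) (mset (map (conj_class G) gs))"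

definition list_prod :: "('a, 'b) monoid_scheme \<Rightarrow> 'a list \<Rightarrow> 'a"
  where "list_prod G gs = foldr (\<otimes>\<^bsub>G\<^esub>) gs \<one>\<^bsub>G\<^esub>"

definition singular_data_monoid :: "('a, 'b) monoid_scheme \<Rightarrow> 'a set multiset monoid"
  where "singular_data_monoid G =
    \<lparr>carrier = {class_tuple G gs | gs.
        set gs \<subseteq> carrier G - {\<one>\<^bsub>G\<^esub>} \<and> list_prod G gs \<in> derived G (carrier G)},
     monoid.mult = (+),
     one = {#}\<rparr>"

inductive_set cancelling :: "('a, 'b) monoid_scheme \<Rightarrow> 'a set multiset set"
  for G :: "('a, 'b) monoid_scheme"
  where
    cancelling_empty: "{#} \<in> cancelling G"
  | cancelling_pair: "\<lbrakk>M \<in> cancelling G; g \<in> carrier G\<rbrakk>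
      \<Longrightarrow> class_tuple G [g, inv\<^bsub>G\<^esub> g] + M \<in> cancelling G"

text \<open>
  The congruence defining the quotient of a commutative monoid by a submonoid:
  two elements are identified when they agree after adding elements of the submonoid.
\<close>

definition singular_data_rel ::
    "('a, 'b) monoid_scheme \<Rightarrow> ('a set multiset \<times> 'a set multiset) set"
  where "singular_data_rel G =
    {(A, B). A \<in> carrier (singular_data_monoid G) \<and> B \<in> carrier (singular_data_monoid G) \<and>
       (\<exists>M \<in> cancelling G. \<exists>N \<in> cancelling G. A + M = B + N)}"

definition singular_data_group :: "('a, 'b) monoid_scheme \<Rightarrow> 'a set multiset set monoid"
  where "singular_data_group G =
    \<lparr>carrier = carrier (singular_data_monoid G) // singular_data_rel G,
     monoid.mult = (\<lambda>X Y. \<Union>A\<in>X. \<Union>B\<in>Y. singular_data_rel G `` {A \<otimes>\<^bsub>singular_data_monoid G\<^esub> B}),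
     one = singular_data_rel G `` {\<one>\<^bsub>singular_data_monoid G\<^esub>}\<rparr>"

definition mat_trace :: "'a::comm_monoid_add mat \<Rightarrow> 'a"
  where "mat_trace A = (\<Sum>i<dim_row A. A $$ (i, i))"

definition complex_representation ::
    "('a, 'b) monoid_scheme \<Rightarrow> nat \<Rightarrow> ('a \<Rightarrow> complex mat) \<Rightarrow> bool"
  where "complex_representation G n \<rho> \<longleftrightarrow>
    \<rho> \<in> hom G (units_of (ring_mat TYPE(complex) n ()))"

text \<open>
  Only the values of a character on \<open>carrier G\<close> are meaningful.
\<close>

definition complex_character :: "('a, 'b) monoid_scheme \<Rightarrow> ('a \<Rightarrow> complex) \<Rightarrow> bool"
  where "complex_character G \<chi> \<longleftrightarrow>
    (\<exists>n \<rho>. complex_representation G n \<rho> \<and> (\<forall>g \<in> carrier G. \<chi> g = mat_trace (\<rho> g)))"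


lemma class_tuple_Nil [simp]: "class_tuple G [] = {#}"
  by (simp add: class_tuple_def)

lemma class_tuple_append: "class_tuple G (gs @ hs) = class_tuple G gs + class_tuple G hs"
  by (simp add: class_tuple_def)

lemma class_tuple_Cons: "class_tuple G (g # gs) = class_tuple G [g] + class_tuple G gs"
  by (simp add: class_tuple_def)

lemma class_tuple_rev [simp]: "class_tuple G (rev gs) = class_tuple G gs"
  by (simp add: class_tuple_def rev_map[symmetric])

lemma cancelling_add:
  assumes "M \<in> cancelling G" "N \<in> cancelling G"
  shows "M + N \<in> cancelling G"
  using assms by induction (auto intro: cancelling.intros simp: add.assoc)

context group
begin

lemma list_prod_Nil [simp]: "list_prod G [] = \<one>"
  by (simp add: list_prod_def)

lemma list_prod_Cons [simp]: "list_prod G (g # gs) = g \<otimes> list_prod G gs"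
  by (simp add: list_prod_def)

lemma list_prod_closed [simp]: "set gs \<subseteq> carrier G \<Longrightarrow> list_prod G gs \<in> carrier G"
  by (induction gs) auto

lemma list_prod_append:
  assumes "set gs \<subseteq> carrier G" "set hs \<subseteq> carrier G"
  shows "list_prod G (gs @ hs) = list_prod G gs \<otimes> list_prod G hs"
  using assms by (induction gs) (auto simp: m_assoc)

lemma list_prod_inv_rev:
  assumes "set gs \<subseteq> carrier G"
  shows "list_prod G (map (m_inv G) (rev gs)) = inv (list_prod G gs)"
  using assms
proof (induction gs)
  case (Cons g gs)
  then have "set (map (m_inv G) (rev gs)) \<subseteq> carrier G" "set [inv g] \<subseteq> carrier G"
    by auto
  with Cons show ?case
    by (simp add: list_prod_append inv_mult_group)
qed simp

lemma mem_conj_class: "h \<in> conj_class G g \<longleftrightarrow> (\<exists>x\<in>carrier G. h = x \<otimes> g \<otimes> inv x)"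
  by (auto simp: conj_class_def orbit_def)

lemma conj_class_refl: "g \<in> carrier G \<Longrightarrow> g \<in> conj_class G g"
  by (auto simp: mem_conj_class intro!: bexI[of _ \<one>])

lemma conj_class_one: "conj_class G \<one> = {\<one>}"
  using conj_class_refl[OF one_closed] by (auto simp: mem_conj_class)

lemma conj_class_eq_one_iff:
  assumes "g \<in> carrier G"
  shows "conj_class G g = conj_class G \<one> \<longleftrightarrow> g = \<one>"
  using conj_class_refl[OF assms] by (auto simp: conj_class_one)

lemma class_tuple_nontrivial:
  assumes "set gs \<subseteq> carrier G - {\<one>}"
  shows "class_tuple G gs = mset (map (conj_class G) gs)"
  using assms conj_class_eq_one_iff by (induction gs) (auto simp: class_tuple_def)

lemma derived_subgroup: "subgroup (derived G (carrier G)) G"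
  by (rule derived_is_subgroup) simp

lemma derived_coset_hom:
  "(\<lambda>g. derived G (carrier G) #> g) \<in> hom G (G Mod derived G (carrier G))"
  using normal.r_coset_hom_Mod[OF derived_self_is_normal] .

lemma list_prod_mem_derived_iff:
  assumes gs: "set gs \<subseteq> carrier G" and hs: "set hs \<subseteq> carrier G"
    and eq: "mset (map (conj_class G) gs) = mset (map (conj_class G) hs)"
  shows "list_prod G gs \<in> derived G (carrier G) \<longleftrightarrow> list_prod G hs \<in> derived G (carrier G)"
proof -
  let ?D = "derived G (carrier G)"
  let ?Q = "G Mod ?D"
  let ?f = "\<lambda>g. ?D #> g"
  interpret Q: comm_group ?Q
    by (rule derived_quot_is_comm_group)
  interpret f: group_hom G ?Q ?f
    using derived_coset_hom by unfold_locales
  have conj: "?f h = ?f g" if g: "g \<in> carrier G" and h: "h \<in> conj_class G g" for g h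
  proof -
    obtain x where x: "x \<in> carrier G" "h = x \<otimes> g \<otimes> inv x"
      using h by (auto simp: mem_conj_class)
    have "?f h = ?f x \<otimes>\<^bsub>?Q\<^esub> ?f g \<otimes>\<^bsub>?Q\<^esub> inv\<^bsub>?Q\<^esub> ?f x"
      using x g by (simp add: f.hom_mult f.hom_inv)
    also have "\<dots> = ?f g \<otimes>\<^bsub>?Q\<^esub> (?f x \<otimes>\<^bsub>?Q\<^esub> inv\<^bsub>?Q\<^esub> ?f x)"
      using x(1) g f.hom_closed by (metis Q.inv_closed Q.m_assoc Q.m_comm)
    also have "\<dots> = ?f g"
      using x(1) g f.hom_closed by (metis Q.r_inv Q.r_one)
    finally show ?thesis .
  qed
  define r where "r C = (SOME h. h \<in> C)" for C :: "'a set"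
  have r: "?f (r (conj_class G g)) = ?f g" if "g \<in> carrier G" for g
    using conj[OF that] someI[of "\<lambda>h. h \<in> conj_class G g", OF conj_class_refl[OF that]]
    unfolding r_def by blast
  have prod: "?f (list_prod G ks) = finprod ?Q (\<lambda>i. ?f (ks ! i)) {..<length ks}"
    if "set ks \<subseteq> carrier G" for ks
    using that
  proof (induction ks rule: rev_induct)
    case Nil
    then show ?case using f.hom_one by simp
  next
    case (snoc k ks)
    have cl: "?f (ks ! i) \<in> carrier ?Q" if "i < length ks" for i
      using snoc.prems that by (intro f.hom_closed) (auto simp: subset_iff)
    have k: "?f k \<in> carrier ?Q"
      using snoc.prems by (intro f.hom_closed) auto
    have "finprod ?Q (\<lambda>i. ?f ((ks @ [k]) ! i)) {..<Suc (length ks)}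
        = ?f k \<otimes>\<^bsub>?Q\<^esub> finprod ?Q (\<lambda>i. ?f ((ks @ [k]) ! i)) {..<length ks}"
      unfolding lessThan_Suc using cl k by (subst Q.finprod_insert) (auto simp: nth_append)
    also have "finprod ?Q (\<lambda>i. ?f ((ks @ [k]) ! i)) {..<length ks}
        = finprod ?Q (\<lambda>i. ?f (ks ! i)) {..<length ks}"
      using cl by (intro Q.finprod_cong') (auto simp: nth_append)
    also have "\<dots> = ?f (list_prod G ks)"
      using snoc by simp
    also have "?f k \<otimes>\<^bsub>?Q\<^esub> ?f (list_prod G ks) = ?f (list_prod G ks) \<otimes>\<^bsub>?Q\<^esub> ?f k"
      using snoc.prems k by (intro Q.m_comm f.hom_closed list_prod_closed) auto
    also have "\<dots> = ?f (list_prod G (ks @ [k]))"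
      using snoc.prems by (simp add: list_prod_append f.hom_mult)
    finally show ?case by simp
  qed
  obtain p where p: "p permutes {..<length gs}"
      "permute_list p (map (conj_class G) gs) = map (conj_class G) hs"
    using mset_eq_permutation[OF eq[symmetric]] by auto
  have len: "length hs = length gs"
    using eq by (metis length_map mset_eq_length)
  have nth: "?f (hs ! i) = ?f (gs ! p i)" if "i < length gs" for i
  proof -
    have pi: "p i < length gs"
      using permutes_in_image[OF p(1)] that by auto
    have "conj_class G (hs ! i) = permute_list p (map (conj_class G) gs) ! i"
      using that len by (simp add: p(2))
    also have "\<dots> = conj_class G (gs ! p i)"
      using that pi p(1) by (simp add: permute_list_nth)
    finally show ?thesis
      using r[of "hs ! i"] r[of "gs ! p i"] gs hs len that pi
      by (metis nth_mem subsetD)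
  qed
  have cl: "?f (gs ! i) \<in> carrier ?Q" if "i < length gs" for i
    using gs that by (intro f.hom_closed) (auto simp: subset_iff)
  have "?f (list_prod G hs) = finprod ?Q (\<lambda>i. ?f (gs ! p i)) {..<length gs}"
    unfolding prod[OF hs] len
    using nth cl permutes_in_image[OF p(1)] by (intro Q.finprod_cong') auto
  also have "\<dots> = finprod ?Q (\<lambda>i. ?f (gs ! i)) (p ` {..<length gs})"
    using cl permutes_image[OF p(1)] permutes_inj_on[OF p(1)]
    by (subst Q.finprod_reindex) auto
  also have "\<dots> = ?f (list_prod G gs)"
    using permutes_image[OF p(1)] prod[OF gs] by simp
  finally have "?f (list_prod G hs) = ?f (list_prod G gs)" .
  moreover have "list_prod G ks \<in> ?D \<longleftrightarrow> ?f (list_prod G ks) = ?D"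
    if "set ks \<subseteq> carrier G" for ks
    using that derived_subgroup
    by (metis coset_join1 coset_join2 list_prod_closed subgroup.subset)
  ultimately show ?thesis
    using gs hs by simp
qed

lemma singular_data_monoid_mem_iff:
  "mset (map (conj_class G) gs) \<in> carrier (singular_data_monoid G) \<longleftrightarrow>
    list_prod G gs \<in> derived G (carrier G)"
  if "set gs \<subseteq> carrier G - {\<one>}"
proof
  assume "mset (map (conj_class G) gs) \<in> carrier (singular_data_monoid G)"
  then obtain hs where hs: "mset (map (conj_class G) gs) = class_tuple G hs"
      "set hs \<subseteq> carrier G - {\<one>}" "list_prod G hs \<in> derived G (carrier G)"
    by (auto simp: singular_data_monoid_def)
  then show "list_prod G gs \<in> derived G (carrier G)"
    using list_prod_mem_derived_iff[of gs hs] that by (auto simp: class_tuple_nontrivial)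
next
  assume "list_prod G gs \<in> derived G (carrier G)"
  then show "mset (map (conj_class G) gs) \<in> carrier (singular_data_monoid G)"
    using that by (auto simp: singular_data_monoid_def class_tuple_nontrivial intro!: exI[of _ gs])
qed

lemma comm_monoid_singular_data_monoid: "comm_monoid (singular_data_monoid G)"
proof (rule comm_monoidI)
  fix A B
  assume "A \<in> carrier (singular_data_monoid G)" "B \<in> carrier (singular_data_monoid G)"
  then obtain gs hs where
      "A = class_tuple G gs" "set gs \<subseteq> carrier G - {\<one>}" "list_prod G gs \<in> derived G (carrier G)"
      "B = class_tuple G hs" "set hs \<subseteq> carrier G - {\<one>}" "list_prod G hs \<in> derived G (carrier G)"
    by (auto simp: singular_data_monoid_def)
  moreover from this have "list_prod G (gs @ hs) \<in> derived G (carrier G)"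
    using derived_subgroup by (subst list_prod_append) (auto simp: subgroup.m_closed)
  ultimately show "A \<otimes>\<^bsub>singular_data_monoid G\<^esub> B \<in> carrier (singular_data_monoid G)"
    by (auto simp: singular_data_monoid_def class_tuple_append intro!: exI[of _ "gs @ hs"])
next
  show "\<one>\<^bsub>singular_data_monoid G\<^esub> \<in> carrier (singular_data_monoid G)"
    using subgroup.one_closed[OF derived_subgroup]
    by (auto simp: singular_data_monoid_def intro!: exI[of _ "[]"])
qed (auto simp: singular_data_monoid_def add_ac)

lemma cancelling_subset: "cancelling G \<subseteq> carrier (singular_data_monoid G)"
proof
  interpret L: comm_monoid "singular_data_monoid G"
    by (rule comm_monoid_singular_data_monoid)
  fix M assume "M \<in> cancelling G"
  then show "M \<in> carrier (singular_data_monoid G)"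
  proof induction
    case cancelling_empty
    then show ?case
      using L.one_closed by (simp add: singular_data_monoid_def)
  next
    case (cancelling_pair M g)
    have "class_tuple G [g, inv g] \<in> carrier (singular_data_monoid G)"
    proof (cases "g = \<one>")
      case True
      then show ?thesis
        using L.one_closed by (simp add: class_tuple_def singular_data_monoid_def)
    next
      case False
      then have "inv g \<noteq> \<one>"
        using cancelling_pair.hyps by simp
      with False show ?thesis
        using cancelling_pair.hyps subgroup.one_closed[OF derived_subgroup]
        by (auto simp: singular_data_monoid_def simp del: inv_eq_1_iff intro!: exI[of _ "[g, inv g]"])
    qed
    then show ?case
      using L.m_closed[OF _ cancelling_pair.IH] by (simp add: singular_data_monoid_def)
  qed
qed

lemma equiv_singular_data_rel:
  "equiv (carrier (singular_data_monoid G)) (singular_data_rel G)"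
proof (rule equivI)
  show "singular_data_rel G \<subseteq> carrier (singular_data_monoid G) \<times> carrier (singular_data_monoid G)"
    by (auto simp: singular_data_rel_def)
  show "refl_on (carrier (singular_data_monoid G)) (singular_data_rel G)"
    by (auto simp: refl_on_def singular_data_rel_def intro: cancelling_empty)
  show "sym (singular_data_rel G)"
    unfolding singular_data_rel_def by (rule symI, simp only: mem_Collect_eq prod.case) metis
  show "trans (singular_data_rel G)"
  proof (rule transI)
    fix A B C
    assume "(A, B) \<in> singular_data_rel G" "(B, C) \<in> singular_data_rel G"
    then obtain M N P Q where *: "A \<in> carrier (singular_data_monoid G)"
        "C \<in> carrier (singular_data_monoid G)" "M \<in> cancelling G" "N \<in> cancelling G"
        "P \<in> cancelling G" "Q \<in> cancelling G" "A + M = B + N" "B + P = C + Q"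
      by (auto simp: singular_data_rel_def)
    then have "A + (M + P) = C + (Q + N)"
      by (metis add.assoc add.commute)
    with * show "(A, C) \<in> singular_data_rel G"
      by (auto simp: singular_data_rel_def intro: cancelling_add)
  qed
qed

lemma singular_data_rel_add:
  assumes "(A, A') \<in> singular_data_rel G" "(B, B') \<in> singular_data_rel G"
  shows "(A + B, A' + B') \<in> singular_data_rel G"
proof -
  interpret L: comm_monoid "singular_data_monoid G"
    by (rule comm_monoid_singular_data_monoid)
  obtain M N P Q where *: "A \<in> carrier (singular_data_monoid G)"
      "A' \<in> carrier (singular_data_monoid G)" "B \<in> carrier (singular_data_monoid G)"
      "B' \<in> carrier (singular_data_monoid G)" "M \<in> cancelling G" "N \<in> cancelling G"
      "P \<in> cancelling G" "Q \<in> cancelling G" "A + M = A' + N" "B + P = B' + Q"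
    using assms by (auto simp: singular_data_rel_def)
  have "(A + B) + (M + P) = (A + M) + (B + P)"
    by (simp add: add_ac)
  also have "\<dots> = (A' + B') + (N + Q)"
    unfolding * by (simp add: add_ac)
  finally have "(A + B) + (M + P) = (A' + B') + (N + Q)" .
  moreover have "A + B \<in> carrier (singular_data_monoid G)" "A' + B' \<in> carrier (singular_data_monoid G)"
    using L.m_closed * by (simp_all add: singular_data_monoid_def)
  ultimately show ?thesis
    using * by (auto simp: singular_data_rel_def intro: cancelling_add)
qed

lemma singular_data_group_mult:
  assumes "A \<in> carrier (singular_data_monoid G)" "B \<in> carrier (singular_data_monoid G)"
  shows "singular_data_rel G `` {A} \<otimes>\<^bsub>singular_data_group G\<^esub> singular_data_rel G `` {B}
    = singular_data_rel G `` {A + B}"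
proof -
  have "congruent2 (singular_data_rel G) (singular_data_rel G)
      (\<lambda>A B. singular_data_rel G `` {A + B})"
    using singular_data_rel_add
    by (intro congruent2I'[OF equiv_class_eq[OF equiv_singular_data_rel]]) auto
  from UN_equiv_class2[OF equiv_singular_data_rel equiv_singular_data_rel this assms]
  show ?thesis
    by (simp add: singular_data_group_def singular_data_monoid_def)
qed

lemma class_tuple_inverse:
  assumes "set gs \<subseteq> carrier G"
  shows "class_tuple G gs + class_tuple G (map (m_inv G) gs) \<in> cancelling G"
  using assms
proof (induction gs)
  case (Cons g gs)
  have "class_tuple G (g # gs) + class_tuple G (map (m_inv G) (g # gs))
      = class_tuple G [g, inv g] + (class_tuple G gs + class_tuple G (map (m_inv G) gs))"
    by (simp add: class_tuple_def)
  with Cons show ?case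
    by (auto intro: cancelling.intros)
qed (simp add: cancelling_empty)

lemma comm_group_singular_data_group: "comm_group (singular_data_group G)"
proof (rule comm_groupI)
  let ?L = "carrier (singular_data_monoid G)" and ?R = "singular_data_rel G"
  let ?B = "singular_data_group G"
  interpret L: comm_monoid "singular_data_monoid G"
    by (rule comm_monoid_singular_data_monoid)
  have carr: "carrier ?B = ?L // ?R" and one: "\<one>\<^bsub>?B\<^esub> = ?R `` {{#}}"
    by (simp_all add: singular_data_group_def singular_data_monoid_def)
  have add: "A + B \<in> ?L" if "A \<in> ?L" "B \<in> ?L" for A B
    using L.m_closed[OF that] by (simp add: singular_data_monoid_def)
  have zero: "{#} \<in> ?L"
    using L.one_closed by (simp add: singular_data_monoid_def)
  note mult = singular_data_group_mult
  show "\<one>\<^bsub>?B\<^esub> \<in> carrier ?B"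
    unfolding carr one using zero by (rule quotientI)
  show "X \<otimes>\<^bsub>?B\<^esub> Y \<in> carrier ?B" if "X \<in> carrier ?B" "Y \<in> carrier ?B" for X Y
    using that unfolding carr by (auto elim!: quotientE simp: mult intro!: quotientI add)
  show "X \<otimes>\<^bsub>?B\<^esub> Y \<otimes>\<^bsub>?B\<^esub> Z = X \<otimes>\<^bsub>?B\<^esub> (Y \<otimes>\<^bsub>?B\<^esub> Z)"
    if "X \<in> carrier ?B" "Y \<in> carrier ?B" "Z \<in> carrier ?B" for X Y Z
    using that unfolding carr by (auto elim!: quotientE simp: mult add add.assoc)
  show "X \<otimes>\<^bsub>?B\<^esub> Y = Y \<otimes>\<^bsub>?B\<^esub> X" if "X \<in> carrier ?B" "Y \<in> carrier ?B" for X Y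
    using that unfolding carr by (auto elim!: quotientE simp: mult add.commute)
  show "\<one>\<^bsub>?B\<^esub> \<otimes>\<^bsub>?B\<^esub> X = X" if "X \<in> carrier ?B" for X
    using that unfolding carr one by (auto elim!: quotientE simp: mult zero)
  show "\<exists>Y\<in>carrier ?B. Y \<otimes>\<^bsub>?B\<^esub> X = \<one>\<^bsub>?B\<^esub>" if X: "X \<in> carrier ?B" for X
  proof -
    obtain gs where gs: "X = ?R `` {class_tuple G gs}" "class_tuple G gs \<in> ?L"
        "set gs \<subseteq> carrier G - {\<one>}" "list_prod G gs \<in> derived G (carrier G)"
      using X unfolding carr
      by (auto elim!: quotientE simp: singular_data_monoid_def)
    define hs where "hs = map (m_inv G) (rev gs)"
    have "list_prod G hs \<in> derived G (carrier G)"
      using gs subgroup.m_inv_closed[OF derived_subgroup] unfolding hs_def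
      by (subst list_prod_inv_rev) auto
    moreover have "set hs \<subseteq> carrier G - {\<one>}"
      using gs(3) by (auto simp: hs_def)
    ultimately have hs: "class_tuple G hs \<in> ?L"
      by (auto simp: singular_data_monoid_def)
    have "class_tuple G hs + class_tuple G gs \<in> cancelling G"
      using class_tuple_inverse[of gs] gs(3)
      by (auto simp: hs_def rev_map[symmetric] add.commute)
    then have "(class_tuple G hs + class_tuple G gs, {#}) \<in> ?R"
      using hs gs(2) zero add cancelling_empty by (force simp: singular_data_rel_def)
    then have "?R `` {class_tuple G hs} \<otimes>\<^bsub>?B\<^esub> X = \<one>\<^bsub>?B\<^esub>"
      unfolding one gs(1) mult[OF hs gs(2)] by (rule equiv_class_eq[OF equiv_singular_data_rel])
    then show ?thesis
      using hs unfolding carr by (auto intro: quotientI)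
  qed
qed

end

end

theory Submission
  imports
    Defs
    "HOL-Algebra.Multiplicative_Group"
    "Jordan_Normal_Form.Determinant"
begin

text \<open>
  Both sides say that every element of \<open>G\<close> is conjugate to its inverse. Cancellation preserves
  the difference of the multiplicities of the classes of \<open>g\<close> and \<open>inv g\<close>; the tuple
  consisting of \<open>|G|\<close> copies of the class of \<open>g\<close> lies in the monoid because \<open>g [^] |G| = \<one>\<close>,
  and its double vanishes only if these two classes coincide. On the other side
  \<open>\<chi> (inv g) = cnj (\<chi> g)\<close>, so all characters are real iff no character distinguishes \<open>g\<close> from
  \<open>inv g\<close>. That characters separate conjugacy classes is obtained without the theory of
  irreducible representations: the characters induced from the cyclic group generated by \<open>h\<close> suffice
  to recognise the class of \<open>h\<close>.
\<close>

section \<open>Inversion of conjugacy classes and the exponent of the group of singular orbit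
  data\<close>

context group
begin

lemma conj_class_sym:
  assumes "g \<in> carrier G" "h \<in> conj_class G g"
  shows "g \<in> conj_class G h"
proof -
  obtain x where x: "x \<in> carrier G" "h = x \<otimes> g \<otimes> inv x"
    using assms(2) by (auto simp: mem_conj_class)
  then have "g = inv x \<otimes> h \<otimes> inv (inv x)"
    using assms(1) by (simp add: m_assoc inv_solve_left)
  then show ?thesis
    using x(1) unfolding mem_conj_class by blast
qed

lemma conj_class_subset:
  assumes "g \<in> carrier G" "h \<in> conj_class G g"
  shows "conj_class G h \<subseteq> conj_class G g"
proof -
  obtain x where x: "x \<in> carrier G" "h = x \<otimes> g \<otimes> inv x"
    using assms(2) by (auto simp: mem_conj_class)
  then have "y \<otimes> h \<otimes> inv y = (y \<otimes> x) \<otimes> g \<otimes> inv (y \<otimes> x)" if "y \<in> carrier G" for y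
    using that assms(1) by (simp add: m_assoc inv_mult_group)
  then show ?thesis
    using m_closed[OF _ x(1)] unfolding mem_conj_class subset_iff by metis
qed

lemma conj_class_eqI:
  assumes "g \<in> carrier G" "h \<in> conj_class G g"
  shows "conj_class G h = conj_class G g"
proof -
  have "h \<in> carrier G"
    using assms by (auto simp: mem_conj_class)
  then show ?thesis
    using conj_class_subset conj_class_sym assms by (metis subset_antisym)
qed

lemma conj_class_inv_cong:
  assumes "g \<in> carrier G" "h \<in> carrier G" "conj_class G g = conj_class G h"
  shows "conj_class G (inv g) = conj_class G (inv h)"
proof -
  obtain x where x: "x \<in> carrier G" "g = x \<otimes> h \<otimes> inv x"
    using conj_class_refl[OF assms(1)] assms(3) by (auto simp: mem_conj_class)
  then have "inv g = x \<otimes> inv h \<otimes> inv x"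
    using assms(2) by (simp add: m_assoc inv_mult_group)
  then show ?thesis
    using x(1) assms(2) by (intro conj_class_eqI) (auto simp: mem_conj_class)
qed

text \<open>Inversion is a well-defined involution on conjugacy classes, so it may be moved across
  an equation.\<close>

lemma conj_class_eq_inv_iff:
  assumes "g \<in> carrier G" "h \<in> carrier G"
  shows "conj_class G (inv g) = conj_class G h \<longleftrightarrow> conj_class G g = conj_class G (inv h)"
  using conj_class_inv_cong[of "inv g" h] conj_class_inv_cong[of g "inv h"] assms by auto

text \<open>A generating pair holds the classes of \<open>x\<close> and \<open>inv x\<close> once
  each, and inversion swaps these two entries. So multiplicities in sums of such pairs are invariant
  under inversion.\<close>

lemma count_cancelling_inv:
  assumes "M \<in> cancelling G" "g \<in> carrier G"
  shows "count M (conj_class G g) = count M (conj_class G (inv g))"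
  using assms(1)
proof induction
  case (cancelling_pair M x)
  have "conj_class G g = conj_class G (inv x) \<longleftrightarrow> conj_class G (inv g) = conj_class G x"
    using conj_class_eq_inv_iff[of g x] assms(2) cancelling_pair.hyps by auto
  moreover have "conj_class G g = conj_class G x \<longleftrightarrow> conj_class G (inv g) = conj_class G (inv x)"
    using conj_class_eq_inv_iff[of g "inv x"] assms(2) cancelling_pair.hyps by auto
  \<comment> \<open>\<open>x\<close> and \<open>inv x\<close> are trivial together, so deleting the
    identity class removes both entries of a pair or neither.\<close>
  moreover have "conj_class G (inv x) = conj_class G \<one> \<longleftrightarrow> conj_class G x = conj_class G \<one>"
    using conj_class_eq_one_iff[of x] conj_class_eq_one_iff[of "inv x"] cancelling_pair.hyps by auto
  then have "count (class_tuple G [x, inv x]) C = (if conj_class G x = conj_class G \<one> then 0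
      else of_bool (C = conj_class G x) + of_bool (C = conj_class G (inv x)))" for C
    by (auto simp: class_tuple_def)
  ultimately show ?case
    using cancelling_pair.IH by simp
qed simp

lemma singular_data_group_exponent_two_iff:
  assumes "finite (carrier G)"
  shows "(\<forall>\<alpha> \<in> carrier (singular_data_group G).
            \<alpha> [^]\<^bsub>singular_data_group G\<^esub> (2::nat) = \<one>\<^bsub>singular_data_group G\<^esub>)
     \<longleftrightarrow> (\<forall>g \<in> carrier G. inv g \<in> conj_class G g)"
proof -
  let ?L = "carrier (singular_data_monoid G)" and ?R = "singular_data_rel G"
  let ?B = "singular_data_group G"
  interpret L: comm_monoid "singular_data_monoid G"
    by (rule comm_monoid_singular_data_monoid)
  interpret B: comm_group ?B
    by (rule comm_group_singular_data_group)
  have carr: "carrier ?B = ?L // ?R" and one: "\<one>\<^bsub>?B\<^esub> = ?R `` {{#}}"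
    by (simp_all add: singular_data_group_def singular_data_monoid_def)
  have zero: "{#} \<in> ?L"
    using L.one_closed by (simp add: singular_data_monoid_def)
  have add: "A + A \<in> ?L" if "A \<in> ?L" for A
    using L.m_closed[OF that that] by (simp add: singular_data_monoid_def)
  have double: "(?R `` {A}) [^]\<^bsub>?B\<^esub> (2::nat) = \<one>\<^bsub>?B\<^esub> \<longleftrightarrow> (A + A, {#}) \<in> ?R"
    if A: "A \<in> ?L" for A
  proof -
    have "?R `` {A} \<in> carrier ?B"
      unfolding carr using A by (rule quotientI)
    then have "(?R `` {A}) [^]\<^bsub>?B\<^esub> (2::nat) = ?R `` {A + A}"
      using singular_data_group_mult[OF A A] by (simp add: numeral_2_eq_2)
    then show ?thesis
      unfolding one using eq_equiv_class_iff[OF equiv_singular_data_rel add[OF A] zero] by simp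
  qed
  show ?thesis
  proof
    assume exp2: "\<forall>\<alpha> \<in> carrier ?B. \<alpha> [^]\<^bsub>?B\<^esub> (2::nat) = \<one>\<^bsub>?B\<^esub>"
    show "\<forall>g \<in> carrier G. inv g \<in> conj_class G g"
    proof
      fix g assume g: "g \<in> carrier G"
      show "inv g \<in> conj_class G g"
      proof (cases "g = \<one>")
        case True
        then show ?thesis by (simp add: conj_class_one)
      next
        case False
        define gs where "gs = replicate (Coset.order G) g"
        have gs: "set gs \<subseteq> carrier G - {\<one>}"
          using g False by (auto simp: gs_def)
        have "list_prod G (replicate k g) = g [^] k" for k
          using g by (induction k) (simp_all only: replicate_Suc list_prod_Cons nat_pow_Suc2, simp)
        then have "list_prod G gs \<in> derived G (carrier G)"
          using subgroup.one_closed[OF derived_subgroup] g by (simp add: gs_def pow_order_eq_1)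
        moreover define A where "A = mset (map (conj_class G) gs)"
        ultimately have A: "A \<in> ?L"
          using singular_data_monoid_mem_iff[OF gs] by simp
        have A_eq: "A = replicate_mset (Coset.order G) (conj_class G g)"
          by (simp add: A_def gs_def)
        have "(A + A, {#}) \<in> ?R"
          using exp2 double[OF A] quotientI[OF A] carr by auto
        then obtain M N where MN: "M \<in> cancelling G" "N \<in> cancelling G" "A + A + M = N"
          by (auto simp: singular_data_rel_def)
        \<comment> \<open>In \<open>A + A + M = N\<close> the counts in \<open>M\<close> and
          \<open>N\<close> are invariant under inversion, hence so are those in
          \<open>A + A\<close>. There the class of \<open>g\<close> has multiplicity twice the group
          order, which is positive, and any other class has multiplicity 0.\<close>
        have "count (A + A) (conj_class G g) = count (A + A) (conj_class G (inv g))"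
          using count_cancelling_inv[OF MN(1) g] count_cancelling_inv[OF MN(2) g]
          by (simp flip: MN(3))
        moreover have "Coset.order G > 0"
          using assms order_gt_0_iff_finite by simp
        ultimately have "conj_class G (inv g) = conj_class G g"
          by (auto simp: A_eq split: if_splits)
        then show ?thesis
          using conj_class_refl[of "inv g"] g by simp
      qed
    qed
  next
    assume real: "\<forall>g \<in> carrier G. inv g \<in> conj_class G g"
    show "\<forall>\<alpha> \<in> carrier ?B. \<alpha> [^]\<^bsub>?B\<^esub> (2::nat) = \<one>\<^bsub>?B\<^esub>"
    proof
      fix \<alpha> assume "\<alpha> \<in> carrier ?B"
      then obtain A where A: "\<alpha> = ?R `` {A}" "A \<in> ?L"
        unfolding carr by (auto elim!: quotientE)
      then obtain gs where gs: "A = class_tuple G gs" "set gs \<subseteq> carrier G"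
        by (auto simp: singular_data_monoid_def)
      \<comment> \<open>Inversion fixes every class here, so the inverse tuple cancelling
        \<open>A\<close> is \<open>A\<close> itself.\<close>
      have "map (conj_class G) (map (m_inv G) gs) = map (conj_class G) gs"
        using gs(2) real by (auto intro!: conj_class_eqI)
      then have "class_tuple G (map (m_inv G) gs) = A"
        unfolding gs(1) class_tuple_def by (simp only:)
      then have "A + A \<in> cancelling G"
        using class_tuple_inverse[OF gs(2)] gs(1) by simp
      then have "(A + A, {#}) \<in> ?R"
        using add[OF A(2)] zero cancelling_empty by (force simp: singular_data_rel_def)
      then show "\<alpha> [^]\<^bsub>?B\<^esub> (2::nat) = \<one>\<^bsub>?B\<^esub>"
        using double A by simp
    qed
  qed
qed

end

section \<open>Traces and matrix representations\<close>

lemma mat_trace_comm: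
  fixes A B :: "'a::comm_semiring_0 mat"
  assumes "A \<in> carrier_mat n m" "B \<in> carrier_mat m n"
  shows "mat_trace (A * B) = mat_trace (B * A)"
proof -
  have "mat_trace (A * B) = (\<Sum>i<n. \<Sum>k<m. A $$ (i, k) * B $$ (k, i))"
    using assms by (auto simp: mat_trace_def scalar_prod_def atLeast0LessThan intro!: sum.cong)
  also have "\<dots> = (\<Sum>k<m. \<Sum>i<n. B $$ (k, i) * A $$ (i, k))"
    by (subst sum.swap) (simp add: mult.commute)
  also have "\<dots> = mat_trace (B * A)"
    using assms by (auto simp: mat_trace_def scalar_prod_def atLeast0LessThan intro!: sum.cong)
  finally show ?thesis .
qed

context group
begin

lemma complex_representationD:
  assumes "complex_representation G n \<rho>"
  shows "g \<in> carrier G \<Longrightarrow> \<rho> g \<in> carrier_mat n n"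
    and "\<lbrakk>g \<in> carrier G; h \<in> carrier G\<rbrakk> \<Longrightarrow> \<rho> (g \<otimes> h) = \<rho> g * \<rho> h"
    and "\<rho> \<one> = 1\<^sub>m n"
proof -
  let ?M = "ring_mat TYPE(complex) n ()"
  interpret M: ring ?M by (rule ring_mat)
  interpret U: group "units_of ?M" by (rule M.units_group)
  interpret group_hom G "units_of ?M" \<rho>
    using assms by unfold_locales (simp add: complex_representation_def)
  show "\<rho> g \<in> carrier_mat n n" if "g \<in> carrier G" for g
    using hom_closed[OF that] by (simp add: units_of_carrier Units_def ring_mat_simps)
  show "\<rho> (g \<otimes> h) = \<rho> g * \<rho> h" if "g \<in> carrier G" "h \<in> carrier G" for g h
    using hom_mult[OF that] by (simp add: units_of_mult ring_mat_simps)
  show "\<rho> \<one> = 1\<^sub>m n"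
    using hom_one by (simp add: units_of_one ring_mat_simps)
qed

lemma complex_representationI:
  assumes carr: "\<And>g. g \<in> carrier G \<Longrightarrow> \<rho> g \<in> carrier_mat n n"
    and mult: "\<And>g h. \<lbrakk>g \<in> carrier G; h \<in> carrier G\<rbrakk> \<Longrightarrow> \<rho> (g \<otimes> h) = \<rho> g * \<rho> h"
    and one: "\<rho> \<one> = 1\<^sub>m n"
  shows "complex_representation G n \<rho>"
proof -
  \<comment> \<open>Multiplicativity makes \<open>\<rho> (inv g)\<close> a two-sided inverse of
    \<open>\<rho> g\<close>.\<close>
  have "\<rho> g \<in> Units (ring_mat TYPE(complex) n ())" if "g \<in> carrier G" for g
    using that carr[of g] carr[of "inv g"] mult[of g "inv g"] mult[of "inv g" g] one
    by (auto simp: Units_def ring_mat_simps intro!: bexI[of _ "\<rho> (inv g)"])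
  then show ?thesis
    using mult by (auto simp: complex_representation_def hom_def units_of_def ring_mat_simps)
qed

section \<open>Characters under inversion and conjugation\<close>

lemma sum_mult_right:
  assumes "x \<in> carrier G"
  shows "(\<Sum>g\<in>carrier G. f (g \<otimes> x)) = (\<Sum>g\<in>carrier G. f g)"
  by (rule sum.reindex_bij_witness[of _ "\<lambda>g. g \<otimes> inv x" "\<lambda>g. g \<otimes> x"])
    (use assms in \<open>auto simp: m_assoc\<close>)

text \<open>
  The matrix \<open>H\<close> of a \<open>G\<close>-invariant Hermitian form intertwines the adjoint of
  \<open>\<rho> x\<close> with \<open>\<rho> (inv x)\<close>; it is invertible because the form is definite.
\<close>

lemma complex_character_inv:
  assumes fin: "finite (carrier G)" and \<chi>: "complex_character G \<chi>" and x: "x \<in> carrier G"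
  shows "\<chi> (inv x) = cnj (\<chi> x)"
proof -
  obtain n \<rho> where rep: "complex_representation G n \<rho>"
      and trace: "\<And>g. g \<in> carrier G \<Longrightarrow> \<chi> g = mat_trace (\<rho> g)"
    using \<chi> by (auto simp: complex_character_def)
  note carr = complex_representationD(1)[OF rep]
  define r where "r g i j = \<rho> g $$ (i, j)" for g i j
  have r_mult: "(\<Sum>k<n. r g i k * r h k j) = r (g \<otimes> h) i j"
    if "g \<in> carrier G" "h \<in> carrier G" "i < n" "j < n" for g h i j
    using that carr[of g] carr[of h] complex_representationD(2)[OF rep that(1,2)]
    by (auto simp: r_def scalar_prod_def atLeast0LessThan)
  have r_one: "r \<one> i j = (if i = j then 1 else 0)" if "i < n" "j < n" for i j
    using that complex_representationD(3)[OF rep] by (simp add: r_def)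
  \<comment> \<open>These are the entries of the sum over \<open>g\<close> of the adjoint of
    \<open>\<rho> g\<close> times \<open>\<rho> g\<close>, i.e. of the standard Hermitian form
    averaged over \<open>G\<close> up to a scalar; \<open>S\<close> below is the adjoint of
    \<open>\<rho> x\<close>.\<close>
  define h where "h i j = (\<Sum>g\<in>carrier G. \<Sum>m<n. cnj (r g m i) * r g m j)" for i j
  define H where "H = mat n n (\<lambda>(i, j). h i j)"
  define S where "S = mat n n (\<lambda>(i, j). cnj (r x j i))"
  have H: "H \<in> carrier_mat n n" and S: "S \<in> carrier_mat n n"
    by (simp_all add: H_def S_def)
  note Rx = carr[OF inv_closed[OF x]]

  \<comment> \<open>Writing * for the adjoint, \<open>\<rho> x\<close>* \<open>\<rho> g\<close>*
    \<open>\<rho> g\<close> equals \<open>\<rho> (g \<otimes> x)\<close>*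
    \<open>\<rho> (g \<otimes> x)\<close> \<open>\<rho> (inv x)\<close>; then
    \<open>g \<otimes> x\<close> is replaced by \<open>g\<close> in the sum over the group.\<close>
  have intertwine: "S * H = H * \<rho> (inv x)"
  proof (rule eq_matI)
    fix i j assume "i < dim_row (H * \<rho> (inv x))" "j < dim_col (H * \<rho> (inv x))"
    then have ij: "i < n" "j < n"
      using H Rx by auto
    have "(S * H) $$ (i, j) = (\<Sum>k<n. \<Sum>g\<in>carrier G. \<Sum>m<n. cnj (r x k i) * (cnj (r g m k) * r g m j))"
      using ij by (simp add: S_def H_def h_def scalar_prod_def atLeast0LessThan sum_distrib_left)
    also have "\<dots> = (\<Sum>g\<in>carrier G. \<Sum>k<n. \<Sum>m<n. cnj (r x k i) * (cnj (r g m k) * r g m j))"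
      by (rule sum.swap)
    also have "\<dots> = (\<Sum>g\<in>carrier G. \<Sum>m<n. cnj (\<Sum>k<n. r g m k * r x k i) * r g m j)"
      by (rule sum.cong[OF refl], subst sum.swap) (simp add: sum_distrib_left sum_distrib_right mult_ac)
    also have "\<dots> = (\<Sum>g\<in>carrier G. \<Sum>m<n. cnj (r (g \<otimes> x) m i) * r (g \<otimes> x \<otimes> inv x) m j)"
      using ij x by (auto simp: r_mult m_assoc intro!: sum.cong)
    also have "\<dots> = (\<Sum>g\<in>carrier G. \<Sum>m<n. cnj (r g m i) * r (g \<otimes> inv x) m j)"
      by (rule sum_mult_right[OF x])
    also have "\<dots> = (\<Sum>g\<in>carrier G. \<Sum>m<n. cnj (r g m i) * (\<Sum>k<n. r g m k * r (inv x) k j))"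
      using ij x by (auto simp: r_mult intro!: sum.cong)
    also have "\<dots> = (\<Sum>g\<in>carrier G. \<Sum>k<n. \<Sum>m<n. cnj (r g m i) * r g m k * r (inv x) k j)"
      by (rule sum.cong[OF refl], subst sum.swap) (simp add: sum_distrib_left mult_ac)
    also have "\<dots> = (\<Sum>k<n. \<Sum>g\<in>carrier G. \<Sum>m<n. cnj (r g m i) * r g m k * r (inv x) k j)"
      by (rule sum.swap)
    also have "\<dots> = (H * \<rho> (inv x)) $$ (i, j)"
      using ij Rx
      by (simp add: H_def h_def r_def[of "inv x"] scalar_prod_def atLeast0LessThan sum_distrib_right)
    finally show "(S * H) $$ (i, j) = (H * \<rho> (inv x)) $$ (i, j)" .
  qed (use H S Rx in auto)

  have "det H \<noteq> 0"
  proof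
    assume "det H = 0"
    then obtain v where v: "v \<in> carrier_vec n" "v \<noteq> 0\<^sub>v n" "H *\<^sub>v v = 0\<^sub>v n"
      using det_0_iff_vec_prod_zero[OF H] by auto
    \<comment> \<open>\<open>w g\<close> is the vector \<open>\<rho> g\<close> applied to
      \<open>v\<close>, and the form at \<open>v\<close> is the sum of the squared norms of all
      \<open>w g\<close>. If it vanishes, the term \<open>g = \<one>\<close> already forces
      \<open>v\<close> to be zero.\<close>
    define w where "w g m = (\<Sum>j<n. r g m j * v $ j)" for g m
    have "(\<Sum>j<n. h i j * v $ j) = (H *\<^sub>v v) $ i" if "i < n" for i
      using that v(1) by (simp add: H_def scalar_prod_def atLeast0LessThan)
    then have "0 = (\<Sum>i<n. cnj (v $ i) * (\<Sum>j<n. h i j * v $ j))"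
      using v(3) by simp
    also have "\<dots> = (\<Sum>i<n. \<Sum>j<n. \<Sum>g\<in>carrier G. \<Sum>m<n.
        cnj (r g m i * v $ i) * (r g m j * v $ j))"
      by (simp add: h_def sum_distrib_left sum_distrib_right mult_ac)
    also have "\<dots> = (\<Sum>i<n. \<Sum>g\<in>carrier G. \<Sum>m<n. \<Sum>j<n.
        cnj (r g m i * v $ i) * (r g m j * v $ j))"
      by (rule sum.cong[OF refl], subst sum.swap, rule sum.cong[OF refl], rule sum.swap)
    also have "\<dots> = (\<Sum>g\<in>carrier G. \<Sum>m<n. \<Sum>i<n. \<Sum>j<n.
        cnj (r g m i * v $ i) * (r g m j * v $ j))"
      by (subst sum.swap, rule sum.cong[OF refl], rule sum.swap)
    also have "\<dots> = (\<Sum>g\<in>carrier G. \<Sum>m<n. cnj (w g m) * w g m)"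
      by (simp only: w_def cnj_sum sum_product)
    also have "\<dots> = complex_of_real (\<Sum>g\<in>carrier G. \<Sum>m<n. (cmod (w g m))\<^sup>2)"
      by (simp add: complex_norm_square mult.commute del: of_real_power)
    finally have "(\<Sum>g\<in>carrier G. \<Sum>m<n. (cmod (w g m))\<^sup>2) = 0"
      by (metis of_real_eq_0_iff)
    then have w0: "w \<one> m = 0" if "m < n" for m
      using that fin by (simp add: sum_nonneg_eq_0_iff sum_nonneg)
    have "w \<one> m = v $ m" if "m < n" for m
    proof -
      have "w \<one> m = (\<Sum>j<n. if m = j then v $ j else 0)"
        unfolding w_def using that by (intro sum.cong) (auto simp: r_one)
      then show ?thesis using that by simp
    qed
    then show False
      using v(1,2) w0 by (auto intro!: eq_vecI)
  qed
  then obtain K where K: "K \<in> carrier_mat n n" "K * H = 1\<^sub>m n" "H * K = 1\<^sub>m n"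
    using det_non_zero_imp_unit[OF H, of "()"] by (auto simp: Units_def ring_mat_simps)
  \<comment> \<open>\<open>K\<close> inverts \<open>H\<close>, so \<open>S\<close> is conjugate to
    \<open>\<rho> (inv x)\<close> and has the same trace.\<close>
  have "S = S * (H * K)"
    using S K by simp
  also have "\<dots> = (S * H) * K"
    using S H K(1) by (simp add: assoc_mult_mat)
  also have "\<dots> = H * (\<rho> (inv x) * K)"
    unfolding intertwine using H K(1) Rx by (simp add: assoc_mult_mat)
  finally have "mat_trace S = mat_trace (\<rho> (inv x) * K * H)"
    using mat_trace_comm[OF H, of "\<rho> (inv x) * K"] K(1) Rx by simp
  also have "\<dots> = mat_trace (\<rho> (inv x))"
    using K(1,2) H Rx by (simp add: assoc_mult_mat[OF Rx K(1) H])
  also have "mat_trace S = cnj (mat_trace (\<rho> x))"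
    using carr[OF x] by (simp add: mat_trace_def S_def r_def)
  finally show ?thesis
    using x by (simp add: trace)
qed

lemma character_eq_on_conj_class:
  assumes "complex_character G \<chi>" "g \<in> carrier G" "h \<in> conj_class G g"
  shows "\<chi> h = \<chi> g"
proof -
  obtain n \<rho> where rep: "complex_representation G n \<rho>"
      and trace: "\<And>g. g \<in> carrier G \<Longrightarrow> \<chi> g = mat_trace (\<rho> g)"
    using assms(1) by (auto simp: complex_character_def)
  obtain x where x: "x \<in> carrier G" "h = x \<otimes> g \<otimes> inv x"
    using assms(3) by (auto simp: mem_conj_class)
  note R = complex_representationD[OF rep]
  have "mat_trace (\<rho> h) = mat_trace (\<rho> (x \<otimes> g) * \<rho> (inv x))"
    using x assms(2) by (simp add: R(2))
  also have "\<dots> = mat_trace (\<rho> (inv x) * \<rho> (x \<otimes> g))"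
    using x assms(2) by (intro mat_trace_comm[of _ n n] R(1)) auto
  also have "\<rho> (inv x) * \<rho> (x \<otimes> g) = \<rho> (inv x \<otimes> (x \<otimes> g))"
    using x(1) assms(2) R(2)[of "inv x" "x \<otimes> g"] by simp
  also have "inv x \<otimes> (x \<otimes> g) = g"
    using x(1) assms(2) by (simp flip: m_assoc)
  finally show ?thesis
    using x assms(2) by (simp add: trace)
qed

section \<open>Characters from idempotents of the group algebra, in particular of cyclic
  subgroups\<close>

text \<open>
  An element \<open>e\<close> of the group algebra with \<open>e * e = e\<close> yields the representation of \<open>G\<close>
  on \<open>\<complex>[G] e\<close>. To avoid choosing a basis, it is complemented by the trivial
  action on \<open>\<complex>[G] (1 - e)\<close>, which only shifts the character by a constant.
\<close>

lemma complex_character_of_idempotent: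
  assumes fin: "finite (carrier G)"
    and idem: "\<And>b. b \<in> carrier G \<Longrightarrow> (\<Sum>y\<in>carrier G. e y * e (inv y \<otimes> b)) = e b"
  obtains c where "complex_character G (\<lambda>g. (\<Sum>x\<in>carrier G. e (inv x \<otimes> g \<otimes> x)) + c)"
proof -
  define n where "n = card (carrier G)"
  obtain f where f: "bij_betw f {..<n} (carrier G)"
    using ex_bij_betw_nat_finite[OF fin] by (auto simp: n_def atLeast0LessThan)
  have fc: "f i \<in> carrier G" if "i < n" for i
    using f that by (auto simp: bij_betw_def)
  \<comment> \<open>In the basis of group elements listed by \<open>f\<close>, \<open>a g\<close> is
    left multiplication by \<open>g\<close> followed by right multiplication by the sum of all
    \<open>e u\<close> times \<open>inv u\<close>, the image of \<open>e\<close> under the inversion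
    anti-automorphism.\<close>
  define a where "a g i j = e (inv (f i) \<otimes> g \<otimes> f j)" for g i j
  define d where "d i j = (if i = j then 1 else 0 :: complex)" for i j :: nat
  \<comment> \<open>By \<open>conv\<close>, \<open>a \<one>\<close> is a projection that fixes every
    \<open>a g\<close> from both sides. Its complement \<open>d - a \<one>\<close> is therefore
    annihilated by every \<open>a g\<close>, which makes \<open>\<rho>\<close> multiplicative, and
    \<open>\<rho> \<one>\<close> is the identity.\<close>
  define \<rho> where "\<rho> g = mat n n (\<lambda>(i, j). a g i j + d i j - a \<one> i j)" for g
  have conv: "(\<Sum>k<n. a g i k * a h k j) = a (g \<otimes> h) i j"
    if g: "g \<in> carrier G" and h: "h \<in> carrier G" and ij: "i < n" "j < n" for g h i j
  proof -
    let ?t = "inv (f i) \<otimes> g" and ?b = "inv (f i) \<otimes> (g \<otimes> h) \<otimes> f j"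
    have t: "?t \<in> carrier G" and b: "?b \<in> carrier G"
      using g h fc[OF ij(1)] fc[OF ij(2)] by auto
    have "(\<Sum>k<n. a g i k * a h k j) = (\<Sum>y\<in>carrier G. e (?t \<otimes> y) * e (inv y \<otimes> h \<otimes> f j))"
      unfolding a_def by (rule sum.reindex_bij_betw[OF f])
    \<comment> \<open>Replacing \<open>?t \<otimes> y\<close> by \<open>y\<close> gives the
      convolution of \<open>e\<close> with itself at \<open>?b\<close>, to which \<open>idem\<close>
      applies.\<close>
    also have "\<dots> = (\<Sum>y\<in>carrier G. e y * e (inv y \<otimes> ?b))"
    proof (rule sum.reindex_bij_witness[of _ "\<lambda>y. inv ?t \<otimes> y" "\<lambda>y. ?t \<otimes> y"])
      fix y assume y: "y \<in> carrier G"
      have "inv (?t \<otimes> y) \<otimes> ?b = inv y \<otimes> (inv ?t \<otimes> (?t \<otimes> (h \<otimes> f j)))"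
        using y t g h fc[OF ij(1)] fc[OF ij(2)] by (simp only: inv_mult_group m_assoc m_closed inv_closed)
      also have "inv ?t \<otimes> (?t \<otimes> (h \<otimes> f j)) = h \<otimes> f j"
        using t h fc[OF ij(2)] by (simp only: m_assoc[symmetric] l_inv l_one m_closed inv_closed)
      finally show "e (?t \<otimes> y) * e (inv (?t \<otimes> y) \<otimes> ?b) = e (?t \<otimes> y) * e (inv y \<otimes> h \<otimes> f j)"
        using y h fc[OF ij(2)] by (simp add: m_assoc)
    qed (use t in \<open>simp_all flip: m_assoc\<close>)
    also have "\<dots> = a (g \<otimes> h) i j"
      using idem[OF b] by (simp add: a_def)
    finally show ?thesis .
  qed
  have "complex_representation G n \<rho>"
  proof (rule complex_representationI)
    fix g h assume g: "g \<in> carrier G" and h: "h \<in> carrier G"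
    show "\<rho> (g \<otimes> h) = \<rho> g * \<rho> h"
    proof (rule eq_matI)
      fix i j assume "i < dim_row (\<rho> g * \<rho> h)" "j < dim_col (\<rho> g * \<rho> h)"
      then have ij: "i < n" "j < n"
        by (auto simp: \<rho>_def)
      have d: "(\<Sum>k<n. p k * d k j) = p j" "(\<Sum>k<n. d i k * p k) = p i" for p
        using ij by (simp_all add: d_def if_distrib if_distribR cong: if_cong)
      have "(\<rho> g * \<rho> h) $$ (i, j)
          = (\<Sum>k<n. (a g i k + d i k - a \<one> i k) * (a h k j + d k j - a \<one> k j))"
        using ij by (simp add: \<rho>_def scalar_prod_def atLeast0LessThan)
      also have "\<dots> = \<rho> (g \<otimes> h) $$ (i, j)"
        using ij g h
        by (simp add: \<rho>_def ring_distribs sum.distrib sum_subtractf conv d)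
      finally show "\<rho> (g \<otimes> h) $$ (i, j) = (\<rho> g * \<rho> h) $$ (i, j)" ..
    qed (simp_all add: \<rho>_def)
  qed (auto simp: \<rho>_def d_def intro!: eq_matI)
  moreover have "mat_trace (\<rho> g)
      = (\<Sum>x\<in>carrier G. e (inv x \<otimes> g \<otimes> x)) + (of_nat n - (\<Sum>i<n. a \<one> i i))" for g
  proof -
    have "(\<Sum>i<n. a g i i) = (\<Sum>x\<in>carrier G. e (inv x \<otimes> g \<otimes> x))"
      unfolding a_def by (rule sum.reindex_bij_betw[OF f])
    then show ?thesis
      by (simp add: mat_trace_def \<rho>_def d_def sum.distrib sum_subtractf)
  qed
  ultimately show thesis
    by (intro that[of "of_nat n - (\<Sum>i<n. a \<one> i i)"])
      (auto simp: complex_character_def intro!: exI[of _ n] exI[of _ \<rho>])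
qed

text \<open>For \<open>h\<close> of finite order and \<open>w ^ ord h = 1\<close>, this is the
  coefficient function of the primitive idempotent of the group algebra of the cyclic group
  generated by \<open>h\<close>, for the linear character with value \<open>inverse w\<close> at
  \<open>h\<close>.\<close>

definition cyclic_idempotent :: "'a \<Rightarrow> complex \<Rightarrow> 'a \<Rightarrow> complex"
  where "cyclic_idempotent h w u = (\<Sum>k<ord h. if h [^] k = u then w ^ k else 0) / of_nat (ord h)"

lemma cyclic_idempotent_shift:
  assumes h: "h \<in> carrier G" and u: "u \<in> carrier G" and w: "w ^ ord h = 1"
  shows "cyclic_idempotent h w (h [^] (k::nat) \<otimes> u) = w ^ k * cyclic_idempotent h w u"
proof (induction k)
  case 0
  then show ?case using u by simp
next
  case (Suc k)
  have step: "cyclic_idempotent h w (h \<otimes> v) = w * cyclic_idempotent h w v"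
    if v: "v \<in> carrier G" for v
  proof -
    define F where "F k = (if h [^] k = h \<otimes> v then w ^ k else 0)" for k :: nat
    \<comment> \<open>The summand is periodic because \<open>h\<close> and \<open>w\<close> both
      have trivial \<open>ord h\<close>-th power, so the summation range may be shifted by
      one.\<close>
    have "F (ord h) = F 0"
      using h w by (simp add: F_def)
    then have "(\<Sum>k<ord h. F k) = (\<Sum>k<ord h. F (Suc k))"
      using sum.lessThan_Suc_shift[of F "ord h"] by simp
    also have "\<dots> = (\<Sum>k<ord h. w * (if h [^] k = v then w ^ k else 0))"
    proof (intro sum.cong refl)
      fix k
      have "h [^] Suc k = h \<otimes> v \<longleftrightarrow> h [^] k = v"
        using h v by (simp only: nat_pow_Suc2 Units_eq Units_l_cancel nat_pow_closed)
      then show "F (Suc k) = w * (if h [^] k = v then w ^ k else 0)"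
        unfolding F_def by simp
    qed
    finally show ?thesis
      by (simp add: cyclic_idempotent_def F_def sum_distrib_left)
  qed
  have "h [^] Suc k \<otimes> u = h \<otimes> (h [^] k \<otimes> u)"
    using h u by (simp only: nat_pow_Suc2 m_assoc nat_pow_closed)
  with Suc step[of "h [^] k \<otimes> u"] h u show ?case
    by simp
qed

text \<open>Only powers \<open>y = h [^] k\<close> contribute. By the shift rule each of the
  \<open>ord h\<close> terms equals the value at \<open>b\<close>, and the denominator averages
  them.\<close>

lemma cyclic_idempotent_convolution:
  assumes fin: "finite (carrier G)" and h: "h \<in> carrier G" and w: "w ^ ord h = 1"
    and b: "b \<in> carrier G"
  shows "(\<Sum>y\<in>carrier G. cyclic_idempotent h w y * cyclic_idempotent h w (inv y \<otimes> b))
    = cyclic_idempotent h w b"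
proof -
  let ?e = "cyclic_idempotent h w"
  have n: "ord h \<noteq> 0"
    using ord_ge_1[OF fin h] by simp
  have "(\<Sum>y\<in>carrier G. ?e y * ?e (inv y \<otimes> b))
      = (\<Sum>y\<in>carrier G. \<Sum>k<ord h. if h [^] k = y then w ^ k * ?e (inv y \<otimes> b) else 0) / of_nat (ord h)"
    by (simp add: cyclic_idempotent_def[of h w y for y] sum_distrib_right sum_divide_distrib
        if_distrib if_distribR cong: if_cong)
  also have "(\<Sum>y\<in>carrier G. \<Sum>k<ord h. if h [^] k = y then w ^ k * ?e (inv y \<otimes> b) else 0)
      = (\<Sum>k<ord h. w ^ k * ?e (inv (h [^] k) \<otimes> b))"
    using fin h by (subst sum.swap) simp
  also have "\<dots> = (\<Sum>k<ord h. ?e b)"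
  proof (intro sum.cong refl)
    fix k
    have "?e (h [^] k \<otimes> (inv (h [^] k) \<otimes> b)) = w ^ k * ?e (inv (h [^] k) \<otimes> b)"
      using h b w by (intro cyclic_idempotent_shift) auto
    then show "w ^ k * ?e (inv (h [^] k) \<otimes> b) = ?e b"
      using h b by (simp flip: m_assoc)
  qed
  finally show ?thesis
    using n by simp
qed

end

section \<open>Roots of unity, Fourier inversion on a cyclic group, and separation of conjugacy
  classes\<close>

lemma sum_powers_root_of_unity:
  fixes n m :: nat
  assumes "n > 0"
  defines "\<zeta> \<equiv> cis (2 * pi / real n)"
  shows "(\<Sum>j<n. (\<zeta> ^ m) ^ j) = (if n dvd m then of_nat n else 0)"
proof -
  have pow: "\<zeta> ^ k = cis (2 * pi * real k / real n)" for k
    by (simp add: \<zeta>_def DeMoivre mult_ac)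
  have one: "\<zeta> ^ n = 1"
    using assms(1) by (simp add: pow)
  have "\<zeta> ^ m = \<zeta> ^ (m mod n)"
    using one by (metis mod_mult_div_eq mult.right_neutral power_add power_mult power_one)
  \<comment> \<open>The powers of \<open>\<zeta>\<close> with exponents below \<open>n\<close> are
    pairwise distinct.\<close>
  moreover have "\<zeta> ^ (m mod n) = 1 \<longleftrightarrow> m mod n = 0"
  proof
    assume "\<zeta> ^ (m mod n) = 1"
    then have "cis (2 * pi * real (m mod n) / real n) = cis (2 * pi * real 0 / real n)"
      by (simp add: pow)
    then show "m mod n = 0"
      using inj_onD[OF bij_betw_imp_inj_on[OF bij_betw_roots_unity[OF assms(1)]], of "m mod n" 0]
        assms(1) by simp
  qed simp
  ultimately have iff: "\<zeta> ^ m = 1 \<longleftrightarrow> n dvd m"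
    by (simp add: dvd_eq_mod_eq_0)
  show ?thesis
  proof (cases "n dvd m")
    case True
    then show ?thesis using iff by simp
  next
    case False
    have "(\<zeta> ^ m) ^ n = 1"
      using one by (metis mult.commute power_mult power_one)
    then show ?thesis
      using False iff by (simp add: sum_gp_strict lessThan_atLeast0[symmetric] geometric_sum)
  qed
qed

context group
begin

text \<open>The exponent \<open>n - 1\<close> plays the role of -1 modulo \<open>n\<close>, avoiding
  negative powers. Orthogonality in \<open>j\<close> leaves only the coefficient of
  \<open>h [^] k\<close> with \<open>k\<close> congruent to 1.\<close>

lemma cyclic_idempotent_fourier_inversion:
  assumes fin: "finite (carrier G)" and h: "h \<in> carrier G"
  defines "n \<equiv> ord h"
  defines "\<zeta> \<equiv> cis (2 * pi / real n)"
  shows "(\<Sum>j<n. \<zeta> ^ (j * (n - 1)) * cyclic_idempotent h (\<zeta> ^ j) u) = (if u = h then 1 else 0)"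
proof -
  have n: "n > 0"
    using ord_ge_1[OF fin h] by (simp add: n_def)
  \<comment> \<open>Writing \<open>1 mod n\<close> includes the case \<open>n = 1\<close>, where
    \<open>h\<close> is trivial and the only index is \<open>k = 0\<close>.\<close>
  have dvd: "n dvd n - 1 + k \<longleftrightarrow> k = 1 mod n" if "k < n" for k
  proof (cases "n = 1")
    case False
    then have "1 < n"
      using n by simp
    show ?thesis
    proof (cases k)
      case 0
      then show ?thesis
        using \<open>1 < n\<close> nat_dvd_not_less[of "n - 1" n] by simp
    next
      case (Suc l)
      then have "n dvd n - 1 + k \<longleftrightarrow> n dvd l"
        using n by simp
      also have "\<dots> \<longleftrightarrow> l = 0"
        using Suc that nat_dvd_not_less[of l n] by auto
      finally show ?thesis
        using Suc \<open>1 < n\<close> by simp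
    qed
  qed (use that in auto)
  have pow: "h [^] (1 mod n) = h"
    using h n ord_eq_1[OF h] by (cases "n = 1") (auto simp: n_def)
  have "(\<Sum>j<n. \<zeta> ^ (j * (n - 1)) * cyclic_idempotent h (\<zeta> ^ j) u)
      = (\<Sum>j<n. \<Sum>k<n. if h [^] k = u then (\<zeta> ^ (n - 1 + k)) ^ j else 0) / of_nat n"
    by (auto simp: cyclic_idempotent_def sum_distrib_left sum_divide_distrib power_mult[symmetric]
        power_add[symmetric] algebra_simps simp flip: n_def intro!: sum.cong)
  also have "(\<Sum>j<n. \<Sum>k<n. if h [^] k = u then (\<zeta> ^ (n - 1 + k)) ^ j else 0)
      = (\<Sum>k<n. if h [^] k = u then \<Sum>j<n. (\<zeta> ^ (n - 1 + k)) ^ j else 0)"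
    by (subst sum.swap) (auto intro!: sum.cong)
  also have "\<dots> = (\<Sum>k<n. if k = 1 mod n then (if h = u then of_nat n else 0) else 0)"
    unfolding \<zeta>_def sum_powers_root_of_unity[OF n]
    using dvd pow by (intro sum.cong) auto
  also have "\<dots> = (if h = u then of_nat n else 0)"
    using n by simp
  finally show ?thesis
    using n by auto
qed

text \<open>
  By Fourier inversion on \<open>\<langle>h\<rangle>\<close>, the characters attached to the idempotents of the cyclic
  group \<open>\<langle>h\<rangle>\<close> combine linearly to the map sending \<open>g\<close> to the number of \<open>x\<close> with
  \<open>inv x \<otimes> g \<otimes> x = h\<close>.
\<close>

lemma characters_separate_conj_classes:
  assumes fin: "finite (carrier G)" and h: "h \<in> carrier G" and g: "g \<in> carrier G"
    and eq: "\<And>\<chi>. complex_character G \<chi> \<Longrightarrow> \<chi> g = \<chi> h"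
  shows "g \<in> conj_class G h"
proof -
  define n where "n = ord h"
  define \<zeta> where "\<zeta> = cis (2 * pi / real n)"
  define e where "e j = cyclic_idempotent h (\<zeta> ^ j)" for j
  have "ord h > 0"
    using ord_ge_1[OF fin h] by simp
  then have "\<zeta> ^ n = 1"
    by (simp add: \<zeta>_def n_def DeMoivre)
  then have w: "(\<zeta> ^ j) ^ ord h = 1" for j
    unfolding n_def by (metis mult.commute power_mult power_one)
  define s where "s j u = (\<Sum>x\<in>carrier G. e j (inv x \<otimes> u \<otimes> x))" for j u
  \<comment> \<open>The constant that comes with the complementary trivial action cancels when the
    values at \<open>g\<close> and \<open>h\<close> are compared.\<close>
  have s: "s j g = s j h" for j
  proof -
    obtain c where "complex_character G (\<lambda>u. s j u + c)"
      using complex_character_of_idempotent[OF fin cyclic_idempotent_convolution[OF fin h w]]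
      unfolding s_def e_def by blast
    from eq[OF this] show ?thesis by simp
  qed
  have inversion: "(\<Sum>j<n. \<zeta> ^ (j * (n - 1)) * s j u)
      = of_nat (card {x \<in> carrier G. inv x \<otimes> u \<otimes> x = h})" for u
  proof -
    have "(\<Sum>j<n. \<zeta> ^ (j * (n - 1)) * s j u)
        = (\<Sum>x\<in>carrier G. \<Sum>j<n. \<zeta> ^ (j * (n - 1)) * e j (inv x \<otimes> u \<otimes> x))"
      unfolding s_def sum_distrib_left by (rule sum.swap)
    also have "\<dots> = (\<Sum>x\<in>carrier G. if inv x \<otimes> u \<otimes> x = h then 1 else 0)"
      unfolding e_def \<zeta>_def n_def cyclic_idempotent_fourier_inversion[OF fin h] ..
    finally show ?thesis
      using fin by (simp add: sum.If_cases Int_def)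
  qed
  have "(of_nat (card {x \<in> carrier G. inv x \<otimes> g \<otimes> x = h}) :: complex)
      = of_nat (card {x \<in> carrier G. inv x \<otimes> h \<otimes> x = h})"
    unfolding inversion[symmetric] s ..
  then have "card {x \<in> carrier G. inv x \<otimes> g \<otimes> x = h} = card {x \<in> carrier G. inv x \<otimes> h \<otimes> x = h}"
    by (simp only: of_nat_eq_iff)
  \<comment> \<open>At \<open>h\<close> itself the count is positive because of
    \<open>x = \<one>\<close>, so it is positive at \<open>g\<close>, which yields a conjugating
    element.\<close>
  also have "\<one> \<in> {x \<in> carrier G. inv x \<otimes> h \<otimes> x = h}"
    using h by simp
  then have "card {x \<in> carrier G. inv x \<otimes> h \<otimes> x = h} > 0"
    using fin by (auto simp: card_gt_0_iff)
  finally have "{x \<in> carrier G. inv x \<otimes> g \<otimes> x = h} \<noteq> {}"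
    by (auto simp: card_gt_0_iff)
  then obtain x where x: "x \<in> carrier G" "inv x \<otimes> g \<otimes> x = h"
    by auto
  then have "g = x \<otimes> h \<otimes> inv x"
    using g by (simp add: m_assoc flip: x(2)) (simp flip: m_assoc)
  with x(1) show ?thesis
    by (auto simp: mem_conj_class)
qed

section \<open>Reality of all characters and the equivalence\<close>

lemma real_characters_iff:
  assumes fin: "finite (carrier G)"
  shows "(\<forall>\<chi>. complex_character G \<chi> \<longrightarrow> (\<forall>g \<in> carrier G. \<chi> g \<in> \<real>))
     \<longleftrightarrow> (\<forall>g \<in> carrier G. inv g \<in> conj_class G g)"
proof
  assume "\<forall>\<chi>. complex_character G \<chi> \<longrightarrow> (\<forall>g \<in> carrier G. \<chi> g \<in> \<real>)"
  then show "\<forall>g \<in> carrier G. inv g \<in> conj_class G g"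
    \<comment> \<open>A real character takes the same value at \<open>g\<close> and
      \<open>inv g\<close>, so separation makes these conjugate.\<close>
    using complex_character_inv[OF fin] Reals_cnj_iff
    by (auto intro!: characters_separate_conj_classes[OF fin])
next
  assume "\<forall>g \<in> carrier G. inv g \<in> conj_class G g"
  then show "\<forall>\<chi>. complex_character G \<chi> \<longrightarrow> (\<forall>g \<in> carrier G. \<chi> g \<in> \<real>)"
    using character_eq_on_conj_class complex_character_inv[OF fin] by (metis Reals_cnj_iff)
qed

end

theorem proposition25:
  fixes G (structure)
  assumes "group G" and "finite (carrier G)"
  shows "(\<forall>\<alpha> \<in> carrier (singular_data_group G).
            \<alpha> [^]\<^bsub>singular_data_group G\<^esub> (2::nat) = \<one>\<^bsub>singular_data_group G\<^esub>)
     \<longleftrightarrow> (\<forall>\<chi>. complex_character G \<chi> \<longrightarrow> (\<forall>g \<in> carrier G. \<chi> g \<in> \<real>))"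
  using group.singular_data_group_exponent_two_iff[OF assms] group.real_characters_iff[OF assms]
  by simp

end
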